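(* Let $\mathcal{D}=\{(\rho,\theta)\in\mathbb{R}^2:\rho>0,\theta>0\}$, let $\tau>0$ be a constant, and let $p,e,\lambda,\mu,\kappa\in C^\infty(\mathcal{D};\mathbb{R})$ satisfy, on all of $\mathcal{D}$, $\mu\ge0$, $\tfrac23\mu+\lambda\ge0$, $\kappa>0$, $p>0$, $p_\rho>0$, $p_\theta>0$, $e_\theta>0$; put $\nu:=2\mu+\lambda$. Let $\overline{U}=(\overline{\rho},\overline{u},\overline{\theta},\overline{q})^\top\in\mathbb{R}^4$ be any fixed state with $\overline{\rho}>0$ and $\overline{\theta}>0$. Then the Cattaneo-Christov system satisfies the genuine coupling condition at $\overline{U}$: with the matrices $A^0,A^1,B,L$ (depending on $\overline{U}$) given in the context, for every $V\in\mathbb{R}^4$, $V\neq0$, with $BV=LV=0$, one has $$(\lambda A^0+A^1)V\neq0\qquad\text{for all }\lambda\in\mathbb{R}.$$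
   Context: Subscripts $\rho,\theta$ denote partial derivatives; $p$ is the pressure, $e$ the internal energy density, $\kappa$ the heat conductivity, $\lambda,\mu$ viscosity coefficients (the real parameter $\lambda$ in the genuine coupling condition is unrelated to the viscosity coefficient). The matrices are the coefficients of the symmetrized Cattaneo-Christov system for one-dimensional compressible fluid flow, in the state variables $(\rho,u,\theta,q)$ (density, velocity, temperature, heat flux), frozen at $\overline{U}$, i.e. of $A^0U_t+A^1U_x+LU=BU_{xx}$. With all functions evaluated at $(\rho,u,\theta)=(\overline{\rho},\overline{u},\overline{\theta})$: $$A^0=\mathrm{diag}\Big(\frac{p_\rho}{\rho},\,\rho,\,\frac{\rho e_\theta}{\theta},\,\frac{\tau}{\kappa\theta}\Big),\qquad A^1=\begin{pmatrix}\frac{up_\rho}{\rho}&p_\rho&0&0\\ p_\rho&\rho u&p_\theta&0\\ 0&p_\theta&\frac{\rho ue_\theta}{\theta}&\frac1\theta\\ 0&0&\frac1\theta&\frac{\tau u}{\kappa\theta}\end{pmatrix},$$ $$B=\mathrm{diag}(0,\nu,0,0),\qquad L=\mathrm{diag}\Big(0,0,0,\frac{1}{\kappa\theta}\Big).$$ *)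

theory Defs
  imports "HOL-Analysis.Analysis"
begin

section \<open>Smooth functions on an open set\<close>

text \<open>
  \<open>Ck_on k S f\<close> is meant for open \<open>S\<close> only: derivatives are full (not one-sided) derivatives
  at the points of \<open>S\<close>, so that \<open>f\<close> may be arbitrary outside \<open>S\<close>. In finite dimension, \<open>f\<close> is
  \<open>k + 1\<close> times continuously differentiable iff it is differentiable and all its
  directional derivatives are \<open>k\<close> times continuously differentiable.
\<close>

fun Ck_on :: "nat \<Rightarrow> 'a::euclidean_space set \<Rightarrow> ('a \<Rightarrow> real) \<Rightarrow> bool" where
  "Ck_on 0 S f \<longleftrightarrow> continuous_on S f"
| "Ck_on (Suc k) S f \<longleftrightarrow>
     (\<forall>x\<in>S. f differentiable (at x)) \<and>
     (\<forall>v. Ck_on k S (\<lambda>x. frechet_derivative f (at x) v))"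

definition smooth_on :: "'a::euclidean_space set \<Rightarrow> ('a \<Rightarrow> real) \<Rightarrow> bool" where
  "smooth_on S f \<longleftrightarrow> (\<forall>k. Ck_on k S f)"

section \<open>Constitutive functions\<close>

text \<open>Constitutive functions take the pair \<open>(\<rho>, \<theta>)\<close> of density and temperature.\<close>

definition state_domain :: "(real \<times> real) set" where
  "state_domain = {(\<rho>, \<theta>). \<rho> > 0 \<and> \<theta> > 0}"

definition d_rho :: "(real \<times> real \<Rightarrow> real) \<Rightarrow> real \<times> real \<Rightarrow> real" where
  "d_rho f = (\<lambda>(\<rho>, \<theta>). deriv (\<lambda>r. f (r, \<theta>)) \<rho>)"

definition d_theta :: "(real \<times> real \<Rightarrow> real) \<Rightarrow> real \<times> real \<Rightarrow> real" where
  "d_theta f = (\<lambda>(\<rho>, \<theta>). deriv (\<lambda>t. f (\<rho>, t)) \<theta>)"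

section \<open>Coefficients of the symmetrized Cattaneo-Christov system\<close>

text \<open>
  The state vector is \<open>U = (\<rho>, u, \<theta>, q)\<close>; the coefficients belong to
  \<open>A\<^sup>0 U\<^sub>t + A\<^sup>1 U\<^sub>x + L U = B U\<^sub>x\<^sub>x\<close>, frozen at \<open>U\<close>. None of them depends on \<open>q\<close>.
  Matrices are given by their rows.
\<close>

definition diag_matrix :: "'a::zero ^ 'n \<Rightarrow> 'a ^ 'n ^ 'n" where
  "diag_matrix d = (\<chi> i j. if i = j then d $ i else 0)"

definition CC_A0 ::
  "real \<Rightarrow> (real \<times> real \<Rightarrow> real) \<Rightarrow> (real \<times> real \<Rightarrow> real) \<Rightarrow> (real \<times> real \<Rightarrow> real) \<Rightarrow>
   real ^ 4 \<Rightarrow> real ^ 4 ^ 4" where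
  "CC_A0 \<tau> p e \<kappa> U = (let \<rho> = U $ 1; \<theta> = U $ 3 in
     diag_matrix (vector
       [d_rho p (\<rho>, \<theta>) / \<rho>, \<rho>, \<rho> * d_theta e (\<rho>, \<theta>) / \<theta>, \<tau> / (\<kappa> (\<rho>, \<theta>) * \<theta>)]))"

definition CC_A1 ::
  "real \<Rightarrow> (real \<times> real \<Rightarrow> real) \<Rightarrow> (real \<times> real \<Rightarrow> real) \<Rightarrow> (real \<times> real \<Rightarrow> real) \<Rightarrow>
   real ^ 4 \<Rightarrow> real ^ 4 ^ 4" where
  "CC_A1 \<tau> p e \<kappa> U = (let \<rho> = U $ 1; u = U $ 2; \<theta> = U $ 3;
       p\<rho> = d_rho p (\<rho>, \<theta>); p\<theta> = d_theta p (\<rho>, \<theta>); e\<theta> = d_theta e (\<rho>, \<theta>) in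
     vector
      [vector [u * p\<rho> / \<rho>, p\<rho>,     0,              0],
       vector [p\<rho>,         \<rho> * u,  p\<theta>,             0],
       vector [0,          p\<theta>,     \<rho> * u * e\<theta> / \<theta>, 1 / \<theta>],
       vector [0,          0,      1 / \<theta>,          \<tau> * u / (\<kappa> (\<rho>, \<theta>) * \<theta>)]])"

definition CC_B ::
  "(real \<times> real \<Rightarrow> real) \<Rightarrow> real ^ 4 \<Rightarrow> real ^ 4 ^ 4" where
  "CC_B \<nu> U = (let \<rho> = U $ 1; \<theta> = U $ 3 in diag_matrix (vector [0, \<nu> (\<rho>, \<theta>), 0, 0]))"

definition CC_L ::
  "(real \<times> real \<Rightarrow> real) \<Rightarrow> real ^ 4 \<Rightarrow> real ^ 4 ^ 4" where
  "CC_L \<kappa> U = (let \<rho> = U $ 1; \<theta> = U $ 3 in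
     diag_matrix (vector [0, 0, 0, 1 / (\<kappa> (\<rho>, \<theta>) * \<theta>)]))"

section \<open>Genuine coupling\<close>

definition genuine_coupling ::
  "real ^ 'n ^ 'n \<Rightarrow> real ^ 'n ^ 'n \<Rightarrow> real ^ 'n ^ 'n \<Rightarrow> real ^ 'n ^ 'n \<Rightarrow> bool" where
  "genuine_coupling A0 A1 B L \<longleftrightarrow>
     (\<forall>V. V \<noteq> 0 \<and> B *v V = 0 \<and> L *v V = 0 \<longrightarrow>
        (\<forall>s::real. (s *\<^sub>R A0 + A1) *v V \<noteq> 0))"

end

theory Submission
  imports Defs
begin

text \<open>
  The damping \<open>L\<close> removes the heat flux, and the last three rows of the eigenvalue equation,
  read from the bottom up, then successively remove temperature, velocity and density.
\<close>

lemma vector_4 [simp]: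
  "(vector [a, b, c, d] :: 'a::zero ^ 4) $ 1 = a"
  "(vector [a, b, c, d] :: 'a::zero ^ 4) $ 2 = b"
  "(vector [a, b, c, d] :: 'a::zero ^ 4) $ 3 = c"
  "(vector [a, b, c, d] :: 'a::zero ^ 4) $ 4 = d"
  by (simp_all add: vector_def)

text \<open>Off-diagonal summands vanish, so the sum over columns collapses to a single term. This
  evaluates \<open>CC_A0\<close> and \<open>CC_L\<close> entry by entry.\<close>

lemma diag_matrix_mult_vector_nth:
  fixes d V :: "'a::comm_semiring_1 ^ 'n"
  shows "(diag_matrix d *v V) $ i = d $ i * V $ i"
  by (simp add: diag_matrix_def matrix_vector_mult_def if_distrib [of "\<lambda>x. x * _"] cong: if_cong)

theorem lemma4p7:
  fixes \<tau> :: real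
    and p e lam \<mu> \<kappa> :: "real \<times> real \<Rightarrow> real"
    and U :: "real ^ 4"
  assumes "\<tau> > 0"
    and "smooth_on state_domain p"
    and "smooth_on state_domain e"
    and "smooth_on state_domain lam"
    and "smooth_on state_domain \<mu>"
    and "smooth_on state_domain \<kappa>"
    and "\<And>x. x \<in> state_domain \<Longrightarrow> \<mu> x \<ge> 0"
    and "\<And>x. x \<in> state_domain \<Longrightarrow> 2 / 3 * \<mu> x + lam x \<ge> 0"
    and "\<And>x. x \<in> state_domain \<Longrightarrow> \<kappa> x > 0"
    and "\<And>x. x \<in> state_domain \<Longrightarrow> p x > 0"
    and "\<And>x. x \<in> state_domain \<Longrightarrow> d_rho p x > 0"
    and "\<And>x. x \<in> state_domain \<Longrightarrow> d_theta p x > 0"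
    and "\<And>x. x \<in> state_domain \<Longrightarrow> d_theta e x > 0"
    and "U $ 1 > 0"
    and "U $ 3 > 0"
  shows "genuine_coupling (CC_A0 \<tau> p e \<kappa> U) (CC_A1 \<tau> p e \<kappa> U) (CC_B (\<lambda>x. 2 * \<mu> x + lam x) U) (CC_L \<kappa> U)"
proof -
  define \<rho> \<theta> where "\<rho> = U $ 1" and "\<theta> = U $ 3"
  have "(\<rho>, \<theta>) \<in> state_domain"
    using assms(14,15) by (simp add: state_domain_def \<rho>_def \<theta>_def)
  \<comment> \<open>Ensures nonzero pivots for the elimination: 1 / (\<kappa> \<theta>), 1 /
    \<theta>, \<open>d_theta p\<close> and \<open>d_rho p\<close>, in this order.\<close>
  then have pos: "\<kappa> (\<rho>, \<theta>) > 0" "d_rho p (\<rho>, \<theta>) > 0" "d_theta p (\<rho>, \<theta>) > 0"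
    using assms(9,11,12) by auto
  have "\<theta> > 0"
    using assms(15) by (simp add: \<theta>_def)
  show ?thesis
    unfolding genuine_coupling_def
  proof (intro allI impI notI, elim conjE)
    fix V :: "real ^ 4" and s :: real
    assume "V \<noteq> 0" and L: "CC_L \<kappa> U *v V = 0"
      and eq: "(s *\<^sub>R CC_A0 \<tau> p e \<kappa> U + CC_A1 \<tau> p e \<kappa> U) *v V = 0"
    have row: "s * (CC_A0 \<tau> p e \<kappa> U *v V) $ i + (CC_A1 \<tau> p e \<kappa> U *v V) $ i = 0" for i
      using arg_cong [OF eq, of "\<lambda>W. W $ i"]
      by (simp add: matrix_vector_mult_add_rdistrib flip: scaleR_matrix_vector_assoc)
    \<comment> \<open>The instance at \<open>vector _\<close> expands only the product with
      \<open>CC_A1\<close>; diagonal matrices keep their componentwise rule.\<close>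
    note [simp] = diag_matrix_mult_vector_nth CC_A0_def CC_A1_def CC_L_def
      Let_def matrix_vector_mult_def [of "vector _"] sum_4
    have "V $ 4 = 0"
      using arg_cong [OF L, of "\<lambda>W. W $ 4"] pos \<open>\<theta> > 0\<close> by (simp flip: \<rho>_def \<theta>_def)
    \<comment> \<open>As \<open>CC_A0\<close> is diagonal, \<open>s\<close> multiplies only
      \<open>V $ 4\<close> in this row, so any real \<open>s\<close> leaves \<open>V $ 3\<close> /
      \<theta> = 0. In the next two rows \<open>s\<close> likewise meets only the component just
      shown to vanish.\<close>
    moreover from this have "V $ 3 = 0"
      using row [of 4] \<open>\<theta> > 0\<close> by (simp flip: \<rho>_def \<theta>_def)
    moreover from calculation have "V $ 2 = 0"
      using row [of 3] pos by (simp flip: \<rho>_def \<theta>_def)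
    \<comment> \<open>Only the pressure coupling \<open>d_rho p\<close> times \<open>V $ 1\<close>
      survives in the momentum row.\<close>
    moreover from calculation have "V $ 1 = 0"
      using row [of 2] pos by (simp flip: \<rho>_def \<theta>_def)
    ultimately have "V = 0"
      by (simp add: vec_eq_iff forall_4)
    with \<open>V \<noteq> 0\<close> show False ..
  qed
qed

end
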